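(* Assume $\min\{q_1,q_2,q_S\}>0$, $q_1+q_2+q_S=1$, $q_1\ge q_2$, and $y\in[Y_L,Y_{1,\gamma})$. Let $$a_1^\gamma:=\frac{p_1(1-p_2)}{p_1+p_2-p_1p_2},\qquad a_2^\gamma:=\frac{p_2(1-p_1)}{p_1+p_2-p_1p_2},\qquad a_S^\gamma:=\frac{p_1p_2}{p_1+p_2-p_1p_2}$$ with $(p_1,p_2)=(P_{1,\gamma}(y),P_{2,\gamma}(y))$. Then $$\lim_{\gamma\uparrow\infty}a_S^\gamma=0\quad\text{and}\quad\lim_{\gamma\uparrow\infty}\frac{a_1^\gamma}{a_2^\gamma}=1.$$
   Context: Constants: $r\in\mathbb{R}$, $\eta>0$, $\delta>0$, $K>0$, $0<D_2<D_1$; $$\beta:=\Big(\tfrac12-\tfrac{r-\delta}{\eta^2}\Big)+\sqrt{\Big(\tfrac12-\tfrac{r-\delta}{\eta^2}\Big)^2+\tfrac{2r}{\eta^2}}>1,\qquad Y_F:=\frac{\delta K\beta}{D_2(\beta-1)}.$$ For $y>0$: $F(y)=\frac{K}{\beta-1}(y/Y_F)^\beta$ if $y\le Y_F$, $F(y)=\frac{D_2y}{\delta}-K$ if $y>Y_F$; $L(y)=\frac{D_1y}{\delta}-\frac{D_1-D_2}{D_2}\frac{K\beta}{\beta-1}(y/Y_F)^\beta-K$ if $y<Y_F$, $L(y)=\frac{D_2y}{\delta}-K$ if $y\ge Y_F$; $S(y)=\frac{D_2y}{\delta}-K$. $Y_L$ is the unique point of $(0,Y_F)$ such that $S<L<F$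 for $y<Y_L$, $S<L=F$ at $Y_L$, $S<F<L$ on $(Y_L,Y_F)$; and $S=F=L$ for $y\ge Y_F$. Utility $U(x)=-\exp(-\gamma x)$ with $\gamma>0$; $l:=U(L)$, $f:=U(F)$, $s:=U(S)$ (depending on $\gamma$). For $y\in[Y_L,Y_F)$, $$P_{i,\gamma}(y):=\frac{l(y)-f(y)}{q_i(l(y)-f(y))+q_S(l(y)-s(y))},\quad i=1,2,$$ extended to $y=Y_F$ by its left limit $1/(q_i+q_S)$. $Y_{1,\gamma}\in[Y_L,Y_F]$ is the point with $P_{2,\gamma}(Y_{1,\gamma})=1$; it is increasing in $\gamma$ with limit $Y_F$, so a fixed $y\in[Y_L,Y_{1,\gamma})$ remains in this interval for all larger $\gamma$. At $y=Y_L$, where $P_{1,\gamma}=P_{2,\gamma}=0$ and the fractions $\frac{p_1(1-p_2)}{p_1+p_2-p_1p_2}$, $\frac{p_2(1-p_1)}{p_1+p_2-p_1p_2}$, $\frac{p_1p_2}{p_1+p_2-p_1p_2}$ (with $(p_1,p_2)=(P_{1,\gamma}(y),P_{2,\gamma}(y))$) defining $a_1^\gamma$, $a_2^\gamma$, $a_S^\gamma$ are $0/0$, $(a_1^\gamma,a_2^\gamma,a_S^\gamma)$ is understood as the limit as $y\downarrow Y_L$. *)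

theory Defs
  imports Complex_Main
begin

definition beta :: "real \<Rightarrow> real \<Rightarrow> real \<Rightarrow> real" where
  "beta r \<eta> \<delta> =
     (1/2 - (r - \<delta>) / \<eta>\<^sup>2) + sqrt ((1/2 - (r - \<delta>) / \<eta>\<^sup>2)\<^sup>2 + 2 * r / \<eta>\<^sup>2)"

definition YF :: "real \<Rightarrow> real \<Rightarrow> real \<Rightarrow> real \<Rightarrow> real \<Rightarrow> real" where
  "YF r \<eta> \<delta> K D2 = \<delta> * K * beta r \<eta> \<delta> / (D2 * (beta r \<eta> \<delta> - 1))"

(* The payoffs below are meant for y > 0 only; their values at y \<le> 0 are irrelevant. *)

definition payF :: "real \<Rightarrow> real \<Rightarrow> real \<Rightarrow> real \<Rightarrow> real \<Rightarrow> real \<Rightarrow> real" where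
  "payF r \<eta> \<delta> K D2 y =
     (if y \<le> YF r \<eta> \<delta> K D2
      then K / (beta r \<eta> \<delta> - 1) * (y / YF r \<eta> \<delta> K D2) powr beta r \<eta> \<delta>
      else D2 * y / \<delta> - K)"

definition payL :: "real \<Rightarrow> real \<Rightarrow> real \<Rightarrow> real \<Rightarrow> real \<Rightarrow> real \<Rightarrow> real \<Rightarrow> real" where
  "payL r \<eta> \<delta> K D1 D2 y =
     (if y < YF r \<eta> \<delta> K D2
      then D1 * y / \<delta>
           - (D1 - D2) / D2 * (K * beta r \<eta> \<delta> / (beta r \<eta> \<delta> - 1))
             * (y / YF r \<eta> \<delta> K D2) powr beta r \<eta> \<delta>
           - K
      else D2 * y / \<delta> - K)"

definition payS :: "real \<Rightarrow> real \<Rightarrow> real \<Rightarrow> real \<Rightarrow> real" where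
  "payS \<delta> K D2 y = D2 * y / \<delta> - K"

definition YL :: "real \<Rightarrow> real \<Rightarrow> real \<Rightarrow> real \<Rightarrow> real \<Rightarrow> real \<Rightarrow> real" where
  "YL r \<eta> \<delta> K D1 D2 =
     (let F = payF r \<eta> \<delta> K D2; L = payL r \<eta> \<delta> K D1 D2; S = payS \<delta> K D2 in
      THE z. 0 < z \<and> z < YF r \<eta> \<delta> K D2 \<and>
        (\<forall>y. 0 < y \<and> y < z \<longrightarrow> S y < L y \<and> L y < F y) \<and>
        S z < L z \<and> L z = F z \<and>
        (\<forall>y. z < y \<and> y < YF r \<eta> \<delta> K D2 \<longrightarrow> S y < F y \<and> F y < L y))"

definition U :: "real \<Rightarrow> real \<Rightarrow> real" where
  "U \<gamma> x = - exp (- \<gamma> * x)"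

(* In P, the argument q stands for q1 or q2. The else branch is meant for
   y between YL and YF; the value at YF is the left limit of that branch. *)

definition P_frac ::
  "real \<Rightarrow> real \<Rightarrow> real \<Rightarrow> real \<Rightarrow> real \<Rightarrow> real \<Rightarrow> real \<Rightarrow> real \<Rightarrow> real \<Rightarrow> real \<Rightarrow> real" where
  "P_frac r \<eta> \<delta> K D1 D2 q qS \<gamma> y =
     (let l = U \<gamma> (payL r \<eta> \<delta> K D1 D2 y);
          f = U \<gamma> (payF r \<eta> \<delta> K D2 y);
          s = U \<gamma> (payS \<delta> K D2 y)
      in (l - f) / (q * (l - f) + qS * (l - s)))"

definition P ::
  "real \<Rightarrow> real \<Rightarrow> real \<Rightarrow> real \<Rightarrow> real \<Rightarrow> real \<Rightarrow> real \<Rightarrow> real \<Rightarrow> real \<Rightarrow> real \<Rightarrow> real" where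
  "P r \<eta> \<delta> K D1 D2 q qS \<gamma> y =
     (if y = YF r \<eta> \<delta> K D2
      then Lim (at_left (YF r \<eta> \<delta> K D2)) (P_frac r \<eta> \<delta> K D1 D2 q qS \<gamma>)
      else P_frac r \<eta> \<delta> K D1 D2 q qS \<gamma> y)"

definition Y1 ::
  "real \<Rightarrow> real \<Rightarrow> real \<Rightarrow> real \<Rightarrow> real \<Rightarrow> real \<Rightarrow> real \<Rightarrow> real \<Rightarrow> real \<Rightarrow> real" where
  "Y1 r \<eta> \<delta> K D1 D2 q2 qS \<gamma> =
     (THE z. YL r \<eta> \<delta> K D1 D2 \<le> z \<and> z \<le> YF r \<eta> \<delta> K D2 \<and>
             P r \<eta> \<delta> K D1 D2 q2 qS \<gamma> z = 1)"

definition frac1 :: "real \<Rightarrow> real \<Rightarrow> real" where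
  "frac1 p1 p2 = p1 * (1 - p2) / (p1 + p2 - p1 * p2)"

definition frac2 :: "real \<Rightarrow> real \<Rightarrow> real" where
  "frac2 p1 p2 = p2 * (1 - p1) / (p1 + p2 - p1 * p2)"

definition fracS :: "real \<Rightarrow> real \<Rightarrow> real" where
  "fracS p1 p2 = p1 * p2 / (p1 + p2 - p1 * p2)"

(* Evaluates a function g of (P1, P2) at y. At y = YL, where P1 = P2 = 0 and the
   fractions above are 0/0, the value is the right limit. *)

definition at_P ::
  "(real \<Rightarrow> real \<Rightarrow> real) \<Rightarrow>
   real \<Rightarrow> real \<Rightarrow> real \<Rightarrow> real \<Rightarrow> real \<Rightarrow> real \<Rightarrow> real \<Rightarrow> real \<Rightarrow> real \<Rightarrow> real \<Rightarrow> real \<Rightarrow> real" where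
  "at_P g r \<eta> \<delta> K D1 D2 q1 q2 qS \<gamma> y =
     (let h = (\<lambda>z. g (P r \<eta> \<delta> K D1 D2 q1 qS \<gamma> z) (P r \<eta> \<delta> K D1 D2 q2 qS \<gamma> z)) in
      if y = YL r \<eta> \<delta> K D1 D2 then Lim (at_right (YL r \<eta> \<delta> K D1 D2)) h else h y)"

definition a1 ::
  "real \<Rightarrow> real \<Rightarrow> real \<Rightarrow> real \<Rightarrow> real \<Rightarrow> real \<Rightarrow> real \<Rightarrow> real \<Rightarrow> real \<Rightarrow> real \<Rightarrow> real \<Rightarrow> real" where
  "a1 = at_P frac1"

definition a2 ::
  "real \<Rightarrow> real \<Rightarrow> real \<Rightarrow> real \<Rightarrow> real \<Rightarrow> real \<Rightarrow> real \<Rightarrow> real \<Rightarrow> real \<Rightarrow> real \<Rightarrow> real \<Rightarrow> real" where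
  "a2 = at_P frac2"

definition aS ::
  "real \<Rightarrow> real \<Rightarrow> real \<Rightarrow> real \<Rightarrow> real \<Rightarrow> real \<Rightarrow> real \<Rightarrow> real \<Rightarrow> real \<Rightarrow> real \<Rightarrow> real \<Rightarrow> real" where
  "aS = at_P fracS"

end

theory Submission
  imports Defs
begin

text \<open>
  In the scaled variable \<open>x = y / Y\<^sub>F\<close> both \<open>F - S\<close> and \<open>L - S\<close> are affine in the secant slope
  \<open>\<sigma> = (1 - x\<^sup>\<beta>) / (1 - x)\<close>: up to positive constants they equal \<open>(1 - x) (\<beta> - \<sigma>)\<close> and
  \<open>(1 - x) (\<sigma> - 1)\<close>. By convexity \<open>\<sigma>\<close> increases strictly from \<open>1\<close> to \<open>\<beta>\<close> on \<open>(0, 1)\<close>, which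
  yields \<open>Y\<^sub>L\<close>. Everything else is a function of \<open>\<rho> = (l - f) / (l - s)\<close>, since
  \<open>P\<^sub>i = \<rho> / (q\<^sub>i \<rho> + q\<^sub>S)\<close>. As \<open>\<rho>\<close> increases strictly from \<open>0\<close> to \<open>1\<close> on \<open>[Y\<^sub>L, Y\<^sub>F)\<close>, the point
  \<open>Y\<^sub>1\<close> is well defined and lies strictly below \<open>Y\<^sub>F\<close>. For a fixed \<open>y \<in> [Y\<^sub>L, Y\<^sub>F)\<close>, \<open>\<rho> \<rightarrow> 0\<close> as
  \<open>\<gamma> \<rightarrow> \<infinity>\<close>, because \<open>S\<close> is the strictly smallest payoff; and
  \<open>a\<^sub>S = \<rho> / (q\<^sub>S (2 - \<rho>))\<close>, \<open>a\<^sub>1 / a\<^sub>2 = (q\<^sub>S - (1 - q\<^sub>2) \<rho>) / (q\<^sub>S - (1 - q\<^sub>1) \<rho>)\<close>.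
\<close>

section \<open>Secant slopes of a power function\<close>

definition chord :: "real \<Rightarrow> real \<Rightarrow> real" where
  "chord b x = (1 - x powr b) / (1 - x)"

lemma powr_mvt:
  fixes b x z :: real
  assumes "0 < x" "x < z"
  obtains t where "x < t" "t < z" "z powr b - x powr b = (z - x) * (b * t powr (b - 1))"
proof -
  have "((\<lambda>t. t powr b) has_real_derivative b * t powr (b - 1)) (at t)"
    if "x \<le> t" "t \<le> z" for t
    using that assms has_real_derivative_powr[of t b] by simp
  from MVT2[OF \<open>x < z\<close> this] show ?thesis using that by blast
qed

text \<open>Since \<open>t powr b\<close> has increasing derivative, the mean value theorem makes
  its slope over \<open>[x, z]\<close> smaller than that over \<open>[z, 1]\<close>; the slope over
  \<open>[x, 1]\<close> is a weighted mean of the two.\<close>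

lemma chord_strict_mono:
  assumes "1 < b" "0 < x" "x < z" "z < 1"
  shows "chord b x < chord b z"
proof -
  obtain s where s: "x < s" "s < z" "z powr b - x powr b = (z - x) * (b * s powr (b - 1))"
    using powr_mvt assms by blast
  obtain t where t: "z < t" "t < 1" "1 powr b - z powr b = (1 - z) * (b * t powr (b - 1))"
    using powr_mvt[of z 1] assms by auto
  have "s powr (b - 1) < t powr (b - 1)"
    using s t assms by (intro powr_less_mono2) auto
  hence "(z - x) * (b * s powr (b - 1)) < (z - x) * (b * t powr (b - 1))"
    using assms by simp
  hence "1 - x powr b < (1 - x) * (b * t powr (b - 1))"
    using s(3) t(3) by (simp add: algebra_simps)
  moreover have "chord b z = b * t powr (b - 1)"
    unfolding chord_def using t(3) assms by simp
  ultimately show ?thesis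
    unfolding chord_def using assms by (simp add: divide_simps mult.commute)
qed

lemma chord_bounds:
  assumes "1 < b" "0 < x" "x < 1"
  shows "1 < chord b x" "chord b x < b"
proof -
  have "x powr b < x powr 1" using assms by (intro powr_less_mono') auto
  thus "1 < chord b x" using assms by (simp add: chord_def divide_simps)
  obtain t where t: "x < t" "t < 1" "1 powr b - x powr b = (1 - x) * (b * t powr (b - 1))"
    using powr_mvt[of x 1] assms by auto
  have "t powr (b - 1) < 1 powr (b - 1)" using t assms by (intro powr_less_mono2) auto
  thus "chord b x < b" using t(3) assms by (simp add: chord_def)
qed

lemma chord_tendsto: "(chord b \<longlongrightarrow> b) (at_left 1)"
proof -
  have "((\<lambda>t. t powr b) has_real_derivative b * 1 powr (b - 1)) (at 1)"
    by (rule has_real_derivative_powr) simp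
  hence "((\<lambda>x. (x powr b - 1) / (x - 1)) \<longlongrightarrow> b) (at_left 1)"
    by (auto simp: has_field_derivative_iff intro: tendsto_mono[OF at_le])
  moreover have "(x powr b - 1) / (x - 1) = chord b x" for x
    unfolding chord_def by (metis minus_diff_eq minus_divide_divide)
  ultimately show ?thesis by simp
qed

text \<open>The endpoint 0 is included so that the intermediate value theorem can start from
  \<open>chord b 0 = 1\<close>.\<close>

lemma chord_continuous_on:
  assumes "0 < b"
  shows "continuous_on {0..<1} (chord b)"
proof -
  have "continuous_on {0..<1} (\<lambda>x::real. x powr b)"
    using assms by (intro continuous_on_powr' continuous_intros) auto
  thus ?thesis unfolding chord_def
    by (intro continuous_on_divide continuous_on_diff continuous_on_const continuous_on_id) auto
qed

lemma chord_attains: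
  assumes "1 < b" "1 < v" "v < b"
  obtains x where "0 < x" "x < 1" "chord b x = v"
proof -
  have "eventually (\<lambda>x. v < chord b x \<and> 0 < x \<and> x < 1) (at_left 1)"
    using order_tendstoD(1)[OF chord_tendsto \<open>v < b\<close>]
      eventually_at_left_real[of 0 1] by (auto elim: eventually_elim2)
  then obtain u where u: "v < chord b u" "0 < u" "u < 1"
    using eventually_happens by force
  have "continuous_on {0..u} (chord b)"
    by (rule continuous_on_subset[OF chord_continuous_on]) (use assms u in auto)
  moreover have "chord b 0 = 1" using assms by (simp add: chord_def)
  ultimately obtain x where x: "0 \<le> x" "x \<le> u" "chord b x = v"
    using IVT'[of "chord b" 0 v u] u assms by auto
  have "x \<noteq> 0" using x(3) \<open>chord b 0 = 1\<close> assms by auto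
  with x u show ?thesis by (intro that[of x]) auto
qed

section \<open>Ratios of exponential utility gaps\<close>

text \<open>
  With \<open>t = a' / a < 1\<close>, monotonicity of \<open>chord (1 / t)\<close> at \<open>exp (- t b) \<le> exp (- t a)\<close> gives the
  claim with \<open>t b\<close> in place of \<open>b'\<close>, and \<open>t b < b'\<close>.
\<close>

lemma exp_gap_ratio_less:
  fixes a a' b b' :: real
  assumes "0 < a'" "a' < a" "a \<le> b" "a' * b < a * b'"
  shows "(1 - exp (- a')) * (1 - exp (- b)) < (1 - exp (- a)) * (1 - exp (- b'))"
proof -
  define t where "t = a' / a"
  have t: "0 < t" "t < 1" "t * a = a'" using assms by (auto simp: t_def)
  have "t * b < b'" using assms by (simp add: t_def field_simps)
  hence less: "(1 - exp (- a)) * (1 - exp (- (t * b))) < (1 - exp (- a)) * (1 - exp (- b'))"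
    using assms by simp
  have "(1 - exp (- a')) * (1 - exp (- b)) \<le> (1 - exp (- a)) * (1 - exp (- (t * b)))"
  proof (cases "a = b")
    case True
    thus ?thesis using t by (simp add: mult.commute)
  next
    case False
    have powr: "exp (- (t * c)) powr (1 / t) = exp (- c)" for c
      using t by (simp add: exp_powr_real)
    have "chord (1 / t) (exp (- (t * b))) < chord (1 / t) (exp (- (t * a)))"
      using t assms False by (intro chord_strict_mono) auto
    thus ?thesis using t assms False
      unfolding chord_def powr by (simp add: divide_simps mult.commute split: if_splits)
  qed
  with less show ?thesis by linarith
qed

text \<open>The quotient \<open>(l - f) / (l - s)\<close> as a function of \<open>a = F - S\<close> and \<open>b = L - S\<close>.\<close>

definition rel_gain :: "real \<Rightarrow> real \<Rightarrow> real \<Rightarrow> real" where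
  "rel_gain \<gamma> a b = (exp (- \<gamma> * a) - exp (- \<gamma> * b)) / (1 - exp (- \<gamma> * b))"

lemma rel_gain_alt:
  assumes "0 < \<gamma>" "0 < b"
  shows "rel_gain \<gamma> a b = 1 - (1 - exp (- \<gamma> * a)) / (1 - exp (- \<gamma> * b))"
  using assms by (simp add: rel_gain_def field_simps)

lemma rel_gain_bounds:
  assumes "0 < \<gamma>" "0 < a" "a < b"
  shows "0 < rel_gain \<gamma> a b" "rel_gain \<gamma> a b < 1"
  using assms by (simp_all add: rel_gain_def)

text \<open>By \<open>rel_gain_alt\<close> a larger gain means a smaller quotient of gaps, so this
  is \<open>exp_gap_ratio_less\<close> with all arguments scaled by \<gamma>. The last hypothesis is
  \<open>a' / b' < a / b\<close> without division.\<close>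

lemma rel_gain_less:
  assumes "0 < \<gamma>" "0 < a'" "a' < a" "a \<le> b" "0 < b'" "a' * b < a * b'"
  shows "rel_gain \<gamma> a b < rel_gain \<gamma> a' b'"
proof -
  have "(\<gamma> * a') * (\<gamma> * b) < (\<gamma> * a) * (\<gamma> * b')"
    using mult_strict_left_mono[OF assms(6), of "\<gamma> * \<gamma>"] assms(1) by (simp add: algebra_simps)
  hence "(1 - exp (- (\<gamma> * a'))) * (1 - exp (- (\<gamma> * b))) <
         (1 - exp (- (\<gamma> * a))) * (1 - exp (- (\<gamma> * b')))"
    using assms by (intro exp_gap_ratio_less) auto
  thus ?thesis using assms
    by (simp add: rel_gain_alt frac_less_eq divide_less_eq pos_divide_less_eq pos_less_divide_eq
        field_simps)
qed

text \<open>Both exponentials in the numerator vanish, while the denominator tends to 1.\<close>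

lemma rel_gain_tendsto_0:
  assumes "0 < a" "0 < b"
  shows "((\<lambda>\<gamma>. rel_gain \<gamma> a b) \<longlongrightarrow> 0) at_top"
proof -
  have "((\<lambda>\<gamma>. exp (- \<gamma> * c)) \<longlongrightarrow> 0) at_top" if "0 < c" for c :: real
  proof -
    have "filterlim (\<lambda>\<gamma>. \<gamma> * c) at_top at_top"
      using that filterlim_tendsto_pos_mult_at_top[OF tendsto_const _ filterlim_ident, of c]
      by (simp add: mult.commute)
    hence "filterlim (\<lambda>\<gamma>. - (\<gamma> * c)) at_bot at_top"
      by (simp add: filterlim_uminus_at_bot)
    from filterlim_compose[OF exp_at_bot this] show ?thesis by simp
  qed
  hence "((\<lambda>\<gamma>. rel_gain \<gamma> a b) \<longlongrightarrow> (0 - 0) / (1 - 0)) at_top"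
    unfolding rel_gain_def using assms by (intro tendsto_intros) auto
  thus ?thesis by simp
qed

lemma rel_gain_continuous_on:
  assumes "0 < \<gamma>" "continuous_on A f" "continuous_on A g" "\<And>x. x \<in> A \<Longrightarrow> g x \<noteq> 0"
  shows "continuous_on A (\<lambda>x. rel_gain \<gamma> (f x) (g x))"
  unfolding rel_gain_def using assms by (intro continuous_intros) auto

section \<open>The three fractions in terms of \<rho>\<close>

text \<open>Over the common denominator \<open>u * v\<close> a factor \<rho> cancels from each
  fraction. The results are continuous at \<open>\<rho> = 0\<close>, where the original fractions
  are 0/0.\<close>

lemma frac_rel_gain:
  fixes q1 q2 qS \<rho> :: real
  assumes "0 < q1" "0 < q2" "0 < qS" "q1 + q2 + qS = 1" "0 < \<rho>" "\<rho> < 1"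
  defines "p1 \<equiv> \<rho> / (q1 * \<rho> + qS)" and "p2 \<equiv> \<rho> / (q2 * \<rho> + qS)"
  shows "fracS p1 p2 = \<rho> / (qS * (2 - \<rho>))"
    and "frac1 p1 p2 = (qS - (1 - q2) * \<rho>) / (qS * (2 - \<rho>))"
    and "frac2 p1 p2 = (qS - (1 - q1) * \<rho>) / (qS * (2 - \<rho>))"
proof -
  define u v where "u = q1 * \<rho> + qS" and "v = q2 * \<rho> + qS"
  have pos: "0 < u" "0 < v" unfolding u_def v_def using assms by (auto intro: add_pos_pos)
  \<comment> \<open>The weights sum to 1, so \<open>(q1 + q2 + qS) * \<rho>\<close> cancels against
    \<open>- \<rho>\<close>.\<close>
  have uv: "u + v - \<rho> = qS * (2 - \<rho>)"
  proof -
    have "u + v - \<rho> = (q1 + q2 + qS) * \<rho> - \<rho> + qS * (2 - \<rho>)"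
      unfolding u_def v_def by algebra
    thus ?thesis using assms by simp
  qed
  have p: "p1 = \<rho> / u" "p2 = \<rho> / v" by (simp_all add: p1_def p2_def u_def v_def)
  have den: "p1 + p2 - p1 * p2 = \<rho> * (u + v - \<rho>) / (u * v)"
    unfolding p using pos by (simp add: field_simps)
  have 1: "p1 * (1 - p2) = \<rho> * (v - \<rho>) / (u * v)" and 2: "p2 * (1 - p1) = \<rho> * (u - \<rho>) / (u * v)"
    and S: "p1 * p2 = \<rho> * \<rho> / (u * v)"
    unfolding p using pos by (simp_all add: field_simps)
  show "fracS p1 p2 = \<rho> / (qS * (2 - \<rho>))"
    unfolding fracS_def by (subst den, subst S, subst uv) (use pos \<open>0 < \<rho>\<close> in simp)
  have "v - \<rho> = qS - (1 - q2) * \<rho>" "u - \<rho> = qS - (1 - q1) * \<rho>"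
    by (simp_all add: u_def v_def algebra_simps)
  thus "frac1 p1 p2 = (qS - (1 - q2) * \<rho>) / (qS * (2 - \<rho>))"
    and "frac2 p1 p2 = (qS - (1 - q1) * \<rho>) / (qS * (2 - \<rho>))"
    unfolding frac1_def frac2_def den 1 2 uv using pos \<open>0 < \<rho>\<close> by simp_all
qed

section \<open>The payoffs and the point \<open>YL\<close>\<close>

text \<open>The radicand exceeds \<open>(1 - a)\<^sup>2\<close> by
  \<open>2 * \<delta> / \<eta>\<^sup>2\<close>, whatever the sign of \<open>r\<close>, and
  \<open>a + \<bar>1 - a\<bar>\<close> is at least 1.\<close>

lemma beta_gt_1:
  fixes r \<eta> \<delta> :: real
  assumes "0 < \<eta>" "0 < \<delta>"
  shows "1 < beta r \<eta> \<delta>"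
proof -
  define a where "a = 1/2 - (r - \<delta>) / \<eta>\<^sup>2"
  have "a\<^sup>2 + 2 * r / \<eta>\<^sup>2 = (1 - a)\<^sup>2 + 2 * \<delta> / \<eta>\<^sup>2"
    unfolding a_def using assms by (simp add: power2_eq_square field_simps)
  hence "(1 - a)\<^sup>2 < a\<^sup>2 + 2 * r / \<eta>\<^sup>2" using assms by simp
  hence "\<bar>1 - a\<bar> < sqrt (a\<^sup>2 + 2 * r / \<eta>\<^sup>2)"
    using real_sqrt_less_mono by fastforce
  thus ?thesis unfolding beta_def a_def[symmetric] by linarith
qed

locale investment =
  fixes r \<eta> \<delta> K D1 D2 :: real
  assumes pos: "0 < \<eta>" "0 < \<delta>" "0 < K" "0 < D2" and D_less: "D2 < D1"
begin

abbreviation "b \<equiv> beta r \<eta> \<delta>"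
abbreviation "Y \<equiv> YF r \<eta> \<delta> K D2"
abbreviation "YL' \<equiv> YL r \<eta> \<delta> K D1 D2"
abbreviation "F \<equiv> payF r \<eta> \<delta> K D2"
abbreviation "L \<equiv> payL r \<eta> \<delta> K D1 D2"
abbreviation "S \<equiv> payS \<delta> K D2"
abbreviation "\<sigma> y \<equiv> chord b (y / Y)"
abbreviation "\<rho> \<gamma> y \<equiv> rel_gain \<gamma> (F y - S y) (L y - S y)"

text \<open>\<open>k\<close> is the payoff \<open>F Y\<close>; together with \<open>Y_eq\<close> it
  serves as the common unit of all payoffs.\<close>

definition "k = K / (b - 1)"
definition "c = (D1 - D2) / D2"

lemma b_gt_1: "1 < b"
  using beta_gt_1 pos by simp

lemma k_pos: "0 < k" and c_pos: "0 < c"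
  unfolding k_def c_def using b_gt_1 pos D_less by auto

lemma Y_pos: "0 < Y"
  unfolding YF_def using pos b_gt_1 by simp

lemma Y_eq: "D2 * Y / \<delta> = k * b"
  unfolding YF_def k_def using pos b_gt_1 by simp

lemma
  assumes "0 < y" "y < Y"
  shows F_minus_S: "F y - S y = k * (1 - y / Y) * (b - \<sigma> y)"
    and L_minus_S: "L y - S y = k * c * b * (1 - y / Y) * (\<sigma> y - 1)"
proof -
  define x where "x = y / Y"
  have x: "0 < x" "x < 1" using assms Y_pos by (auto simp: x_def)
  have D2y: "D2 * y / \<delta> = k * b * x"
    unfolding Y_eq[symmetric] using Y_pos by (simp add: x_def)
  have "D1 * y / \<delta> = (1 + c) * (D2 * y / \<delta>)"
    using pos by (simp add: c_def field_simps)
  hence D1y: "D1 * y / \<delta> = (1 + c) * (k * b * x)" by (simp only: D2y)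
  have K: "K = k * (b - 1)" using b_gt_1 by (simp add: k_def)
  \<comment> \<open>Replacing \<open>1 - x powr b\<close> by this product lets \<open>1 - x\<close>
    factor out of both differences.\<close>
  have ch: "(1 - x) * chord b x = 1 - x powr b" using x by (simp add: chord_def)
  have "F y - S y = k * x powr b - k * b * x + K"
    unfolding payF_def payS_def D2y x_def[symmetric] k_def[symmetric] using assms by simp
  also have "\<dots> = k * (b * (1 - x) - (1 - x powr b))"
    using K by algebra
  also have "\<dots> = k * (1 - x) * (b - chord b x)" unfolding ch[symmetric] by algebra
  finally show "F y - S y = k * (1 - y / Y) * (b - \<sigma> y)" by (simp add: x_def)
  have "L y - S y = (1 + c) * (k * b * x) - c * (k * b) * x powr b - k * b * x"
    unfolding payL_def payS_def D2y D1y x_def[symmetric] c_def[symmetric] using assms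
    by (simp add: k_def)
  also have "\<dots> = k * c * b * ((1 - x powr b) - (1 - x))" by algebra
  also have "\<dots> = k * c * b * (1 - x) * (chord b x - 1)" unfolding ch[symmetric] by algebra
  finally show "L y - S y = k * c * b * (1 - y / Y) * (\<sigma> y - 1)" by (simp add: x_def)
qed

lemma \<sigma>_bounds:
  assumes "0 < y" "y < Y"
  shows "1 < \<sigma> y" "\<sigma> y < b"
  using chord_bounds[OF b_gt_1, of "y / Y"] assms Y_pos by auto

lemma \<sigma>_less:
  assumes "0 < y" "y < z" "z < Y"
  shows "\<sigma> y < \<sigma> z"
  using assms Y_pos by (intro chord_strict_mono b_gt_1) (auto simp: divide_strict_right_mono)

lemma \<sigma>_tendsto: "(\<sigma> \<longlongrightarrow> b) (at_left Y)"
proof (rule filterlim_compose[OF chord_tendsto])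
  have "((\<lambda>y. y / Y) \<longlongrightarrow> Y / Y) (at_left Y)"
    using Y_pos by (intro tendsto_intros) auto
  moreover have "eventually (\<lambda>y. y / Y \<in> {..<1} - {1}) (at_left Y)"
    using eventually_at_left_real[OF Y_pos] Y_pos by (auto elim!: eventually_mono)
  ultimately show "filterlim (\<lambda>y. y / Y) (at_left 1) (at_left Y)"
    using Y_pos by (auto simp: filterlim_at elim: eventually_mono)
qed

lemma \<sigma>_continuous_on: "continuous_on {0<..<Y} \<sigma>"
  using b_gt_1 Y_pos
  by (intro continuous_on_compose2[OF chord_continuous_on] continuous_intros) auto

lemma S_less:
  assumes "0 < y" "y < Y"
  shows "S y < F y" "S y < L y"
proof -
  have "0 < F y - S y" "0 < L y - S y"
    unfolding F_minus_S[OF assms] L_minus_S[OF assms]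
    using \<sigma>_bounds[OF assms] assms Y_pos k_pos c_pos b_gt_1 by auto
  thus "S y < F y" "S y < L y" by simp_all
qed

text \<open>\<open>L - F\<close> is a positive multiple of \<open>\<sigma> - v\<close>, and the
  increasing \<sigma> crosses the level \<open>v\<close> exactly once.\<close>

lemma YL_props:
  shows "0 < YL'" "YL' < Y" "L YL' = F YL'"
    and "\<And>y. YL' < y \<Longrightarrow> y < Y \<Longrightarrow> F y < L y"
proof -
  \<comment> \<open>The slope at which \<open>c * b * (\<sigma> - 1) = b - \<sigma>\<close>, that
    is, \<open>L - S = F - S\<close>; it is a weighted mean of 1 and \<open>b\<close>.\<close>
  define v where "v = (b + c * b) / (1 + c * b)"
  have cb: "0 < c * b" using c_pos b_gt_1 by simp
  have v: "1 < v" "v < b"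
    using cb b_gt_1 mult_strict_right_mono[OF b_gt_1 cb]
    by (auto simp: v_def field_simps simp del: times_divide_eq_left)
  obtain x where x: "0 < x" "x < 1" "chord b x = v"
    using chord_attains[OF b_gt_1 v] .
  define z where "z = x * Y"
  have z: "0 < z" "z < Y" "\<sigma> z = v" using x Y_pos by (auto simp: z_def)
  have diff: "L y - F y = k * (1 - y / Y) * ((1 + c * b) * (\<sigma> y - v))" if "0 < y" "y < Y" for y
  proof -
    have "L y - F y = k * (1 - y / Y) * ((1 + c * b) * \<sigma> y - (b + c * b))"
      using F_minus_S[OF that] L_minus_S[OF that] by algebra
    also have "(b + c * b) = (1 + c * b) * v" using cb by (simp add: v_def)
    finally show ?thesis by (simp add: algebra_simps)
  qed
  have fac: "0 < k * (1 - y / Y)" "0 < 1 + c * b" if "0 < y" "y < Y" for y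
    using that k_pos Y_pos cb by auto
  define Q where "Q = (\<lambda>z. 0 < z \<and> z < Y \<and>
        (\<forall>y. 0 < y \<and> y < z \<longrightarrow> S y < L y \<and> L y < F y) \<and>
        S z < L z \<and> L z = F z \<and>
        (\<forall>y. z < y \<and> y < Y \<longrightarrow> S y < F y \<and> F y < L y))"
  have "L y < F y" if "0 < y" "y < z" for y
  proof -
    have "L y - F y < 0"
      using diff[of y] fac[of y] \<sigma>_less[of y z] that z by (simp add: mult_pos_neg)
    thus ?thesis by simp
  qed
  moreover have "F y < L y" if "z < y" "y < Y" for y
  proof -
    have "0 < L y - F y"
      using diff[of y] fac[of y] \<sigma>_less[of z y] that z by simp
    thus ?thesis by simp
  qed
  moreover have "L z = F z" using diff[of z] z by simp
  ultimately have "Q z" unfolding Q_def using z S_less by auto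
  \<comment> \<open>For two distinct solutions, the strict inequalities of one contradict
    \<open>L = F\<close> at the other.\<close>
  moreover have "w = z" if "Q w" for w
    using that \<open>Q z\<close> unfolding Q_def by (metis less_irrefl linorder_neqE)
  moreover have "YL' = (THE z. Q z)" by (simp add: YL_def Q_def Let_def)
  ultimately have "Q YL'" by (metis theI)
  thus "0 < YL'" "YL' < Y" "L YL' = F YL'"
    and "\<And>y. YL' < y \<Longrightarrow> y < Y \<Longrightarrow> F y < L y"
    unfolding Q_def by auto
qed

section \<open>Monotonicity and limit of \<rho> below \<open>Y\<close>\<close>

text \<open>As \<open>y\<close> grows, \<open>F - S\<close> decreases, and so does the ratio of
  \<open>F - S\<close> to \<open>L - S\<close>, which is
  \<open>(b - \<sigma>) / (c * b * (\<sigma> - 1))\<close>.\<close>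

lemma \<rho>_less:
  assumes "0 < \<gamma>" "YL' \<le> y" "y < z" "z < Y"
  shows "\<rho> \<gamma> y < \<rho> \<gamma> z"
proof (rule rel_gain_less)
  have y: "0 < y" "y < Y" and z: "0 < z" using assms YL_props(1) by linarith+
  note s = \<sigma>_bounds[OF y] \<sigma>_bounds[OF z \<open>z < Y\<close>] \<sigma>_less[OF y(1) assms(3,4)]
  have x: "0 < 1 - z / Y" "1 - z / Y < 1 - y / Y"
    using assms y z Y_pos by (auto simp: divide_strict_right_mono)
  show "0 < F z - S z" "0 < L z - S z" using S_less[of z] z assms by auto
  show "F y - S y \<le> L y - S y"
    using YL_props(3) YL_props(4)[of y] assms by (cases "y = YL'") auto
  have "k * (1 - z / Y) < k * (1 - y / Y)" "0 < k * (1 - y / Y)" using x k_pos by simp_all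
  with s show "F z - S z < F y - S y"
    unfolding F_minus_S[OF y] F_minus_S[OF z \<open>z < Y\<close>] by (auto intro: mult_strict_mono)
  have "(F y - S y) * (L z - S z) - (F z - S z) * (L y - S y)
      = (k * (1 - y / Y)) * (k * c * b * (1 - z / Y)) * ((b - 1) * (\<sigma> z - \<sigma> y))"
    unfolding F_minus_S[OF y] F_minus_S[OF z \<open>z < Y\<close>] L_minus_S[OF y] L_minus_S[OF z \<open>z < Y\<close>]
    by algebra
  also have "0 < \<dots>"
    using x s k_pos c_pos b_gt_1 by (intro mult_pos_pos) auto
  finally show "(F z - S z) * (L y - S y) < (F y - S y) * (L z - S z)" by simp
qed fact

lemma \<rho>_continuous_on:
  assumes "0 < \<gamma>"
  shows "continuous_on {0<..<Y} (\<rho> \<gamma>)"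
proof -
  have "continuous_on {0<..<Y} (\<lambda>y. F y - S y)"
    by (subst continuous_on_cong[OF refl F_minus_S])
      (use Y_pos in \<open>auto intro!: continuous_intros \<sigma>_continuous_on\<close>)
  moreover have "continuous_on {0<..<Y} (\<lambda>y. L y - S y)"
    by (subst continuous_on_cong[OF refl L_minus_S])
      (use Y_pos in \<open>auto intro!: continuous_intros \<sigma>_continuous_on\<close>)
  ultimately show ?thesis
    using assms S_less(2) by (intro rel_gain_continuous_on) force+
qed

text \<open>Both gaps vanish at \<open>Y\<close>, so the quotient is 0/0 there. The ratio of the
  gaps tends to 0 because \<sigma> tends to \<open>b\<close>, and this controls
  \<open>1 - \<rho>\<close>.\<close>

lemma \<rho>_tendsto_1:
  assumes "0 < \<gamma>"
  shows "(\<rho> \<gamma> \<longlongrightarrow> 1) (at_left Y)"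
proof -
  \<comment> \<open>This is \<open>A / B * exp B\<close> for the scaled gaps \<open>A\<close>,
    \<open>B\<close> below; it bounds \<open>1 - \<rho>\<close> by
    \<open>1 - exp (- A) \<le> A\<close> and
    \<open>B * exp (- B) \<le> 1 - exp (- B)\<close>.\<close>
  define g where
    "g y = (b - \<sigma> y) / (c * b * (\<sigma> y - 1)) * exp (\<gamma> * (k * c * b * (1 - y / Y) * (\<sigma> y - 1)))" for y
  have ev: "eventually (\<lambda>y. 0 < y \<and> y < Y) (at_left Y)"
    using eventually_at_left_real[OF Y_pos] by (auto elim: eventually_mono)
  have "(g \<longlongrightarrow> (b - b) / (c * b * (b - 1)) * exp (\<gamma> * (k * c * b * (1 - Y / Y) * (b - 1)))) (at_left Y)"
    unfolding g_def using b_gt_1 c_pos Y_pos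
    by (intro tendsto_intros \<sigma>_tendsto) auto
  hence g0: "(g \<longlongrightarrow> 0) (at_left Y)" by simp
  have le: "1 - g y \<le> \<rho> \<gamma> y \<and> \<rho> \<gamma> y \<le> 1" if y: "0 < y \<and> y < Y" for y
  proof -
    define A B where "A = \<gamma> * (F y - S y)" and "B = \<gamma> * (L y - S y)"
    have AB: "0 < A" "0 < B" using S_less[of y] y assms by (auto simp: A_def B_def)
    have "1 - exp (- A) \<le> A" using exp_ge_add_one_self[of "- A"] by linarith
    moreover have "B * exp (- B) \<le> 1 - exp (- B)"
      using mult_right_mono[OF exp_ge_add_one_self[of B], of "exp (- B)"]
      by (simp add: exp_minus field_simps)
    ultimately have "(1 - exp (- A)) / (1 - exp (- B)) \<le> A / (B * exp (- B))"
      using AB by (intro frac_le) auto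
    also have "\<dots> = A / B * exp B" using AB by (simp add: exp_minus field_simps)
    also have "A / B = (b - \<sigma> y) / (c * b * (\<sigma> y - 1))"
    proof -
      define M where "M = \<gamma> * (k * (1 - y / Y))"
      have "M \<noteq> 0" using k_pos y Y_pos assms by (auto simp: M_def)
      moreover have "A = M * (b - \<sigma> y)" "B = M * (c * b * (\<sigma> y - 1))"
        using F_minus_S L_minus_S y unfolding A_def B_def M_def by simp_all
      ultimately show ?thesis by simp
    qed
    also have "\<dots> * exp B = g y"
      unfolding g_def B_def using L_minus_S y by simp
    finally have "(1 - exp (- A)) / (1 - exp (- B)) \<le> g y" .
    moreover have "0 \<le> (1 - exp (- A)) / (1 - exp (- B))" using AB by simp
    moreover have "\<rho> \<gamma> y = 1 - (1 - exp (- A)) / (1 - exp (- B))"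
      using rel_gain_alt[OF assms] S_less(2) y by (simp add: A_def B_def)
    ultimately show ?thesis by simp
  qed
  show ?thesis
  proof (rule tendsto_sandwich)
    show "((\<lambda>y. 1 - g y) \<longlongrightarrow> 1) (at_left Y)"
      using tendsto_diff[OF tendsto_const[of 1] g0] by simp
    show "((\<lambda>y. 1) \<longlongrightarrow> (1::real)) (at_left Y)" by simp
  qed (use ev le in \<open>auto elim: eventually_mono\<close>)
qed

section \<open>\<open>P\<close> and \<open>Y1\<close> in terms of \<rho>\<close>

lemma P_frac_eq:
  assumes "0 < \<gamma>" "0 < y" "y < Y"
  shows "P_frac r \<eta> \<delta> K D1 D2 q qS \<gamma> y = \<rho> \<gamma> y / (q * \<rho> \<gamma> y + qS)"
proof -
  define l f s where "l = U \<gamma> (L y)" and "f = U \<gamma> (F y)" and "s = U \<gamma> (S y)"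
  have ls: "0 < l - s" using S_less(2)[OF assms(2,3)] assms(1) by (simp add: l_def s_def U_def)
  \<comment> \<open>Subtracting \<open>S y\<close> from all payoffs rescales exponential utility by
    a common factor, which cancels in the quotient.\<close>
  have "l - f = exp (- \<gamma> * S y) * (exp (- \<gamma> * (F y - S y)) - exp (- \<gamma> * (L y - S y)))"
    "l - s = exp (- \<gamma> * S y) * (1 - exp (- \<gamma> * (L y - S y)))"
    by (simp_all add: l_def f_def s_def U_def algebra_simps flip: exp_add)
  hence "\<rho> \<gamma> y = (l - f) / (l - s)" by (simp add: rel_gain_def)
  hence lf: "l - f = \<rho> \<gamma> y * (l - s)" using ls by simp
  have "P_frac r \<eta> \<delta> K D1 D2 q qS \<gamma> y = (l - f) / (q * (l - f) + qS * (l - s))"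
    by (simp add: P_frac_def Let_def l_def f_def s_def)
  also have "\<dots> = (\<rho> \<gamma> y * (l - s)) / ((q * \<rho> \<gamma> y + qS) * (l - s))"
    unfolding lf by (simp add: algebra_simps)
  finally show ?thesis using ls by simp
qed

lemma P_eq:
  assumes "0 < \<gamma>" "0 < y" "y < Y"
  shows "P r \<eta> \<delta> K D1 D2 q qS \<gamma> y = \<rho> \<gamma> y / (q * \<rho> \<gamma> y + qS)"
  using P_frac_eq assms by (simp add: P_def)

lemma P_YF:
  assumes "0 < \<gamma>" "0 < q" "0 < qS"
  shows "P r \<eta> \<delta> K D1 D2 q qS \<gamma> Y = 1 / (q + qS)"
proof -
  have "((\<lambda>y. \<rho> \<gamma> y / (q * \<rho> \<gamma> y + qS)) \<longlongrightarrow> 1 / (q * 1 + qS)) (at_left Y)"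
    using assms by (intro tendsto_intros \<rho>_tendsto_1) auto
  moreover have "eventually (\<lambda>y. \<rho> \<gamma> y / (q * \<rho> \<gamma> y + qS) = P_frac r \<eta> \<delta> K D1 D2 q qS \<gamma> y) (at_left Y)"
    using eventually_at_left_real[OF Y_pos] P_frac_eq[OF assms(1)]
    by (auto elim!: eventually_mono)
  ultimately have "(P_frac r \<eta> \<delta> K D1 D2 q qS \<gamma> \<longlongrightarrow> 1 / (q + qS)) (at_left Y)"
    using Lim_transform_eventually by fastforce
  thus ?thesis unfolding P_def by (simp add: tendsto_Lim)
qed

lemma \<rho>_YL: "\<rho> \<gamma> YL' = 0"
  using YL_props(3) by (simp add: rel_gain_def)

lemma \<rho>_bounds:
  assumes "0 < \<gamma>" "YL' < y" "y < Y"
  shows "0 < \<rho> \<gamma> y" "\<rho> \<gamma> y < 1"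
proof -
  have "0 < y" using assms YL_props(1) by linarith
  thus "0 < \<rho> \<gamma> y" "\<rho> \<gamma> y < 1"
    using rel_gain_bounds assms S_less(1) YL_props(4) by simp_all
qed

lemma \<rho>_attains:
  assumes "0 < \<gamma>" "0 < v" "v < 1"
  obtains y where "YL' \<le> y" "y < Y" "\<rho> \<gamma> y = v"
proof -
  have "eventually (\<lambda>y. v < \<rho> \<gamma> y \<and> YL' < y \<and> y < Y) (at_left Y)"
    using order_tendstoD(1)[OF \<rho>_tendsto_1[OF assms(1)] assms(3)]
      eventually_at_left_real[OF YL_props(2)] by (auto elim: eventually_elim2)
  then obtain z where z: "v < \<rho> \<gamma> z" "YL' < z" "z < Y"
    using eventually_happens by force
  have "continuous_on {YL'..z} (\<rho> \<gamma>)"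
    using YL_props(1) z by (intro continuous_on_subset[OF \<rho>_continuous_on] assms) auto
  then obtain y where "YL' \<le> y" "y \<le> z" "\<rho> \<gamma> y = v"
    using IVT'[of "\<rho> \<gamma>" YL' v z] z assms \<rho>_YL by auto
  with z show ?thesis by (intro that[of y]) auto
qed

text \<open>Below \<open>Y\<close>, \<open>P = 1\<close> amounts to
  \<open>\<rho> = qS / (1 - q2)\<close>, a level in \<open>(0, 1)\<close> that \<rho> attains
  exactly once.\<close>

lemma Y1_less_YF:
  assumes "0 < \<gamma>" "0 < q2" "0 < qS" "q2 + qS < 1"
  shows "Y1 r \<eta> \<delta> K D1 D2 q2 qS \<gamma> < Y"
proof -
  define Q where "Q = (\<lambda>z. YL' \<le> z \<and> z \<le> Y \<and> P r \<eta> \<delta> K D1 D2 q2 qS \<gamma> z = 1)"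
  have Q_iff: "Q z \<longleftrightarrow> YL' \<le> z \<and> z < Y \<and> \<rho> \<gamma> z = qS / (1 - q2)" for z
  proof (cases "YL' \<le> z \<and> z < Y")
    case True
    hence z: "0 < z" "z < Y" using YL_props(1) by auto
    have "0 \<le> \<rho> \<gamma> z"
      using \<rho>_YL \<rho>_bounds(1)[OF assms(1), of z] True by (cases "z = YL'") auto
    hence "0 < q2 * \<rho> \<gamma> z + qS" using assms by (intro add_nonneg_pos) auto
    hence "P r \<eta> \<delta> K D1 D2 q2 qS \<gamma> z = 1 \<longleftrightarrow> \<rho> \<gamma> z = q2 * \<rho> \<gamma> z + qS"
      unfolding P_eq[OF assms(1) z] by (auto simp: divide_eq_1_iff)
    also have "\<dots> \<longleftrightarrow> \<rho> \<gamma> z = qS / (1 - q2)"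
      using assms by (auto simp: field_simps)
    finally show ?thesis using True by (simp add: Q_def)
  next
    case False
    \<comment> \<open>The value there is \<open>1 / (q2 + qS)\<close>, which exceeds 1.\<close>
    moreover have "P r \<eta> \<delta> K D1 D2 q2 qS \<gamma> Y \<noteq> 1" using P_YF assms by simp
    ultimately show ?thesis unfolding Q_def by (cases "z = Y") auto
  qed
  have "0 < qS / (1 - q2)" "qS / (1 - q2) < 1" using assms by auto
  then obtain z where z: "Q z" unfolding Q_iff using \<rho>_attains[OF assms(1)] by metis
  moreover have "w = z" if "Q w" for w
    using that z \<rho>_less[OF assms(1)] unfolding Q_iff by (metis less_irrefl linorder_neqE)
  moreover have "Y1 r \<eta> \<delta> K D1 D2 q2 qS \<gamma> = (THE z. Q z)" by (simp add: Y1_def Q_def)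
  ultimately have "Y1 r \<eta> \<delta> K D1 D2 q2 qS \<gamma> = z" by (metis the_equality)
  thus ?thesis using z by (simp add: Q_iff)
qed

section \<open>The endpoint convention and the limits in \<gamma>\<close>

text \<open>As \<rho> is continuous with value 0 at \<open>YL\<close>, continuity of
  \<open>h\<close> at 0 turns the right limit into \<open>h 0\<close>; one formula thus covers the
  endpoint too.\<close>

lemma at_P_eq:
  assumes g: "\<And>x. 0 < x \<Longrightarrow> x < 1 \<Longrightarrow> g (x / (q1 * x + qS)) (x / (q2 * x + qS)) = h x"
    and h: "isCont h 0" and y: "0 < \<gamma>" "YL' \<le> y" "y < Y"
  shows "at_P g r \<eta> \<delta> K D1 D2 q1 q2 qS \<gamma> y = h (\<rho> \<gamma> y)"
proof -
  define p where "p = (\<lambda>z. g (P r \<eta> \<delta> K D1 D2 q1 qS \<gamma> z) (P r \<eta> \<delta> K D1 D2 q2 qS \<gamma> z))"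
  have p: "p z = h (\<rho> \<gamma> z)" if z: "YL' < z" "z < Y" for z
  proof -
    have "0 < z" using z YL_props(1) by linarith
    thus ?thesis unfolding p_def using P_eq g \<rho>_bounds y(1) z by simp
  qed
  show ?thesis
  proof (cases "y = YL'")
    case True
    have "isCont (\<rho> \<gamma>) YL'"
      using \<rho>_continuous_on[OF y(1)] YL_props(1,2) by (simp add: continuous_on_eq_continuous_at)
    hence "isCont (\<lambda>z. h (\<rho> \<gamma> z)) YL'"
      using h \<rho>_YL by (intro isCont_o2[of YL' "\<rho> \<gamma>" h]) auto
    hence "((\<lambda>z. h (\<rho> \<gamma> z)) \<longlongrightarrow> h (\<rho> \<gamma> YL')) (at_right YL')"
      by (auto simp: isCont_def intro: tendsto_mono[OF at_le])
    moreover have "eventually (\<lambda>z. h (\<rho> \<gamma> z) = p z) (at_right YL')"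
      using eventually_at_right_real[OF YL_props(2)] p by (auto elim!: eventually_mono)
    ultimately have "(p \<longlongrightarrow> h (\<rho> \<gamma> YL')) (at_right YL')"
      by (rule Lim_transform_eventually)
    thus ?thesis using True by (simp add: at_P_def p_def tendsto_Lim)
  next
    case False
    thus ?thesis using p y by (simp add: at_P_def p_def)
  qed
qed

lemma \<rho>_tendsto_0:
  assumes "YL' \<le> y" "y < Y"
  shows "((\<lambda>\<gamma>. \<rho> \<gamma> y) \<longlongrightarrow> 0) at_top"
proof -
  have "0 < y" using assms YL_props(1) by linarith
  thus ?thesis using S_less[of y] assms by (intro rel_gain_tendsto_0) auto
qed

end

theorem corollary3:
  fixes r \<eta> \<delta> K D1 D2 q1 q2 qS \<gamma>\<^sub>0 y :: real
  assumes "\<eta> > 0" and "\<delta> > 0" and "K > 0" and "0 < D2" and "D2 < D1"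
    and "Min {q1, q2, qS} > 0" and "q1 + q2 + qS = 1" and "q1 \<ge> q2"
    and "\<gamma>\<^sub>0 > 0"
    and "y \<in> {YL r \<eta> \<delta> K D1 D2 ..< Y1 r \<eta> \<delta> K D1 D2 q2 qS \<gamma>\<^sub>0}"
  shows "((\<lambda>\<gamma>. aS r \<eta> \<delta> K D1 D2 q1 q2 qS \<gamma> y) \<longlongrightarrow> 0) at_top \<and>
         ((\<lambda>\<gamma>. a1 r \<eta> \<delta> K D1 D2 q1 q2 qS \<gamma> y / a2 r \<eta> \<delta> K D1 D2 q1 q2 qS \<gamma> y) \<longlongrightarrow> 1) at_top"
proof -
  interpret investment r \<eta> \<delta> K D1 D2
    using assms by unfold_locales auto
  have q: "0 < q1" "0 < q2" "0 < qS" using assms(6) by auto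
  \<comment> \<open>The bound \<open>y < Y\<close> does not involve \<gamma>, so it persists as
    \<gamma> grows.\<close>
  have y: "YL' \<le> y" "y < Y"
    using assms(10) Y1_less_YF[OF \<open>\<gamma>\<^sub>0 > 0\<close> q(2,3)] q assms(7) by auto
  note frac = frac_rel_gain[OF q assms(7)]
  note lim = \<rho>_tendsto_0[OF y]
  \<comment> \<open>The simplified fractions. At 0, \<open>hS\<close> is 0 while \<open>h1\<close>
    and \<open>h2\<close> are both 1/2, which gives the two limits.\<close>
  define hS h1 h2 where "hS x = x / (qS * (2 - x))"
    and "h1 x = (qS - (1 - q2) * x) / (qS * (2 - x))"
    and "h2 x = (qS - (1 - q1) * x) / (qS * (2 - x))" for x
  have cont: "isCont hS 0" "isCont h1 0" "isCont h2 0"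
    unfolding hS_def h1_def h2_def using q by (auto intro!: continuous_intros)
  have eq: "aS r \<eta> \<delta> K D1 D2 q1 q2 qS \<gamma> y = hS (\<rho> \<gamma> y)"
    "a1 r \<eta> \<delta> K D1 D2 q1 q2 qS \<gamma> y = h1 (\<rho> \<gamma> y)"
    "a2 r \<eta> \<delta> K D1 D2 q1 q2 qS \<gamma> y = h2 (\<rho> \<gamma> y)" if "0 < \<gamma>" for \<gamma>
    unfolding aS_def a1_def a2_def
    by (rule at_P_eq[OF _ _ that y], simp add: frac hS_def h1_def h2_def, rule cont)+
  have "((\<lambda>\<gamma>. hS (\<rho> \<gamma> y)) \<longlongrightarrow> hS 0) at_top"
    "((\<lambda>\<gamma>. h1 (\<rho> \<gamma> y) / h2 (\<rho> \<gamma> y)) \<longlongrightarrow> h1 0 / h2 0) at_top"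
    using q by (intro tendsto_divide cont[THEN isCont_tendsto_compose, OF lim]; simp add: h2_def)+
  hence "((\<lambda>\<gamma>. hS (\<rho> \<gamma> y)) \<longlongrightarrow> 0) at_top"
    "((\<lambda>\<gamma>. h1 (\<rho> \<gamma> y) / h2 (\<rho> \<gamma> y)) \<longlongrightarrow> 1) at_top"
    using q by (simp_all add: hS_def h1_def h2_def)
  moreover have "eventually (\<lambda>\<gamma>. hS (\<rho> \<gamma> y) = aS r \<eta> \<delta> K D1 D2 q1 q2 qS \<gamma> y) at_top"
    "eventually (\<lambda>\<gamma>. h1 (\<rho> \<gamma> y) / h2 (\<rho> \<gamma> y) =
       a1 r \<eta> \<delta> K D1 D2 q1 q2 qS \<gamma> y / a2 r \<eta> \<delta> K D1 D2 q1 q2 qS \<gamma> y) at_top"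
    using eq by (auto intro!: eventually_mono[OF eventually_gt_at_top[of 0]])
  ultimately show ?thesis by (blast intro: Lim_transform_eventually)
qed

end
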